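(* For $\lambda>0$ let $u_\lambda:\Gamma\to\mathbb{R}$ be the solution of the discounted Hamilton--Jacobi problem on $\Gamma$ with discount factor $\lambda$. Then, as $\lambda\to0$, the functions $u_\lambda$ converge up to subsequences to a solution of the Eikonal equation on $\Gamma$; that is, every sequence $\lambda_n\to0^+$ has a subsequence along which $u_{\lambda_n}$ converges uniformly on $\Gamma$ to a solution of the Eikonal problem on $\Gamma$.
   Context: Network: $\Gamma=\bigcup_{\gamma\in\mathcal{E}}\gamma([0,1])\subset\mathbb{R}^N$, where $\mathcal{E}$ is a finite collection of regular simple curves $\gamma:[0,1]\to\mathbb{R}^N$ (arcs; closed arcs with $\gamma(0)=\gamma(1)$, and several arcs joining the same points, are allowed). For each arc $\gamma$ the inverse arc $-\gamma$, $(-\gamma)(s)=\gamma(1-s)$, also belongs to $\mathcal{E}$ and is regarded as distinct from $\gamma$; and $\gamma((0,1))\cap\gamma'([0,1])=\emptyset$ whenever $\gamma\ne\pm\gamma'$. The (finitely many) vertices are the initial and terminal points of arcs. $\Gamma$ is connected: any two vertices are linked by a finite concatenation of arcs. Hamiltonians: for each $\gamma\in\mathcal{E}$, $H_\gamma:[0,1]\times\mathbb{R}\to\mathbb{R}$ is continuous in $(s,p)$, coercive in $p$ ($H_\gamma(s,p)\to+\infty$ as $|p|\to\infty$, uniformly in $s$), and $H_{-\gamma}(s,p)=H_\gamma(1-s,-p)$. Moreover, for every $s\in[0,1]$, $H_\gamma(s,\cdot)$ is quasiconvex with $\mathrm{int}\{p:H_\gamma(s,p)\le a\}=\{p:H_\gamma(s,p)<a\}$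 for all $a\in\mathbb{R}$, and $s\mapsto\min_{p}H_\gamma(s,p)$ is constant on $[0,1]$. Equations: for $\lambda\ge0$ let (E$_{\gamma,\lambda}$) be $\lambda w+H_\gamma(s,w')=0$ in $(0,1)$; solutions are continuous functions on $[0,1]$ satisfying it in the viscosity sense in $(0,1)$. A continuous $w$ satisfies the state constraint boundary condition for (E$_{\gamma,\lambda}$) at $s=1$ if $\lambda\varphi(1)+H_\gamma(1,\varphi'(1))\ge0$ for every $C^1$ function $\varphi$ with $\varphi(1)=w(1)$ and $w\ge\varphi$ in $(1-\delta,1)$ for some $\delta>0$. A solution of the $\lambda$-problem on $\Gamma$ is a continuous $u:\Gamma\to\mathbb{R}$ such that $u\circ\gamma$ is a solution of (E$_{\gamma,\lambda}$) for every $\gamma\in\mathcal{E}$ and, for every vertex $x$, there is at least one arc $\gamma$ with $\gamma(1)=x$ such that $u\circ\gamma$ satisfies the state constraint boundary condition for (E$_{\gamma,\lambda}$) at $s=1$. The discounted problem is the $\lambda$-problem with $\lambda>0$ (it has a unique solution $u_\lambda$); the Eikonal problem is the $0$-problem. There is exactly one $a\in\mathbb{R}$ (the critical value) for which the $0$-problem with every $H_\gamma$ replaced by $H_\gamma-a$ has a solution on $\Gamma$; it is assumed that the critical value is $a=0$. *)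

theory Defs
  imports "HOL-Analysis.Analysis"
begin

(* Arcs are total functions on the reals of which only the values on [0,1] matter; the set E of
   arcs contains one representative of each arc.  Two different members of E cannot agree on
   [0,1], by the disjointness condition of network. *)

definition regular_arc :: "(real \<Rightarrow> 'a::euclidean_space) \<Rightarrow> bool" where
  "regular_arc \<gamma> \<longleftrightarrow>
     (\<exists>D. continuous_on {0..1} D \<and>
        (\<forall>s\<in>{0..1}. (\<gamma> has_vector_derivative D s) (at s within {0..1}) \<and> D s \<noteq> 0))"

definition net_vertices :: "(real \<Rightarrow> 'a::euclidean_space) set \<Rightarrow> 'a set" where
  "net_vertices E = pathstart ` E \<union> pathfinish ` E"

definition net_support :: "(real \<Rightarrow> 'a::euclidean_space) set \<Rightarrow> 'a set" where
  "net_support E = (\<Union>\<gamma>\<in>E. path_image \<gamma>)"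

(* simple_path allows closed arcs.  A simple path always differs from its reverse, so \<gamma> and
   reversepath \<gamma> are two distinct members of E. *)

definition network :: "(real \<Rightarrow> 'a::euclidean_space) set \<Rightarrow> bool" where
  "network E \<longleftrightarrow>
     finite E \<and>
     (\<forall>\<gamma>\<in>E. simple_path \<gamma> \<and> regular_arc \<gamma> \<and> reversepath \<gamma> \<in> E) \<and>
     (\<forall>\<gamma>\<in>E. \<forall>\<gamma>'\<in>E. \<gamma>' \<noteq> \<gamma> \<longrightarrow> \<gamma>' \<noteq> reversepath \<gamma> \<longrightarrow>
        \<gamma> ` {0<..<1} \<inter> path_image \<gamma>' = {}) \<and>
     (\<forall>x\<in>net_vertices E. \<forall>y\<in>net_vertices E.
        (x, y) \<in> {(pathstart \<gamma>, pathfinish \<gamma>) | \<gamma>. \<gamma> \<in> E}\<^sup>*)"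

definition hamiltonian :: "(real \<Rightarrow> real \<Rightarrow> real) \<Rightarrow> bool" where
  "hamiltonian h \<longleftrightarrow>
     continuous_on ({0..1} \<times> UNIV) (\<lambda>(s, p). h s p) \<and>
     (\<forall>M. \<exists>R. \<forall>s\<in>{0..1}. \<forall>p. \<bar>p\<bar> \<ge> R \<longrightarrow> h s p \<ge> M) \<and>
     (\<forall>s\<in>{0..1}. \<forall>a. convex {p. h s p \<le> a}) \<and>
     (\<forall>s\<in>{0..1}. \<forall>a. interior {p. h s p \<le> a} = {p. h s p < a}) \<and>
     (\<exists>c. \<forall>s\<in>{0..1}. (\<exists>p. h s p = c) \<and> (\<forall>p. c \<le> h s p))"

definition network_hamiltonian ::
  "(real \<Rightarrow> 'a::euclidean_space) set \<Rightarrow> ((real \<Rightarrow> 'a) \<Rightarrow> real \<Rightarrow> real \<Rightarrow> real) \<Rightarrow> bool" where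
  "network_hamiltonian E H \<longleftrightarrow>
     (\<forall>\<gamma>\<in>E. hamiltonian (H \<gamma>) \<and>
        (\<forall>s\<in>{0..1}. \<forall>p. H (reversepath \<gamma>) s p = H \<gamma> (1 - s) (- p)))"

(* Test functions are C^1 on the whole line.  Since only their germ at the contact point enters,
   this is the same as taking them C^1 near that point (one-sidedly at s = 1). *)

definition viscosity_subsolution :: "real \<Rightarrow> (real \<Rightarrow> real \<Rightarrow> real) \<Rightarrow> (real \<Rightarrow> real) \<Rightarrow> bool" where
  "viscosity_subsolution lam h w \<longleftrightarrow>
     (\<forall>\<phi>. \<forall>s\<in>{0<..<1}. \<phi> C1_differentiable_on UNIV \<and> \<phi> s = w s \<and>
        (\<forall>\<^sub>F t in nhds s. w t \<le> \<phi> t) \<longrightarrow>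
        lam * \<phi> s + h s (deriv \<phi> s) \<le> 0)"

definition viscosity_supersolution :: "real \<Rightarrow> (real \<Rightarrow> real \<Rightarrow> real) \<Rightarrow> (real \<Rightarrow> real) \<Rightarrow> bool" where
  "viscosity_supersolution lam h w \<longleftrightarrow>
     (\<forall>\<phi>. \<forall>s\<in>{0<..<1}. \<phi> C1_differentiable_on UNIV \<and> \<phi> s = w s \<and>
        (\<forall>\<^sub>F t in nhds s. \<phi> t \<le> w t) \<longrightarrow>
        lam * \<phi> s + h s (deriv \<phi> s) \<ge> 0)"

definition viscosity_solution :: "real \<Rightarrow> (real \<Rightarrow> real \<Rightarrow> real) \<Rightarrow> (real \<Rightarrow> real) \<Rightarrow> bool" where
  "viscosity_solution lam h w \<longleftrightarrow>
     continuous_on {0..1} w \<and> viscosity_subsolution lam h w \<and> viscosity_supersolution lam h w"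

definition state_constraint :: "real \<Rightarrow> (real \<Rightarrow> real \<Rightarrow> real) \<Rightarrow> (real \<Rightarrow> real) \<Rightarrow> bool" where
  "state_constraint lam h w \<longleftrightarrow>
     (\<forall>\<phi>. \<phi> C1_differentiable_on UNIV \<and> \<phi> 1 = w 1 \<and>
        (\<exists>\<delta>>0. \<forall>t\<in>{1 - \<delta><..<1}. \<phi> t \<le> w t) \<longrightarrow>
        lam * \<phi> 1 + h 1 (deriv \<phi> 1) \<ge> 0)"

definition network_solution ::
  "(real \<Rightarrow> 'a::euclidean_space) set \<Rightarrow> ((real \<Rightarrow> 'a) \<Rightarrow> real \<Rightarrow> real \<Rightarrow> real) \<Rightarrow> real \<Rightarrow>
   ('a \<Rightarrow> real) \<Rightarrow> bool" where
  "network_solution E H lam u \<longleftrightarrow>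
     continuous_on (net_support E) u \<and>
     (\<forall>\<gamma>\<in>E. viscosity_solution lam (H \<gamma>) (u \<circ> \<gamma>)) \<and>
     (\<forall>x\<in>net_vertices E. \<exists>\<gamma>\<in>E. pathfinish \<gamma> = x \<and> state_constraint lam (H \<gamma>) (u \<circ> \<gamma>))"

abbreviation eikonal_solution ::
  "(real \<Rightarrow> 'a::euclidean_space) set \<Rightarrow> ((real \<Rightarrow> 'a) \<Rightarrow> real \<Rightarrow> real \<Rightarrow> real) \<Rightarrow> ('a \<Rightarrow> real) \<Rightarrow> bool" where
  "eikonal_solution E H u \<equiv> network_solution E H 0 u"

(* On a network with at least one arc exactly one value a has this property; that is a theorem
   about the definition, not part of it. *)

definition is_critical_value ::
  "(real \<Rightarrow> 'a::euclidean_space) set \<Rightarrow> ((real \<Rightarrow> 'a) \<Rightarrow> real \<Rightarrow> real \<Rightarrow> real) \<Rightarrow> real \<Rightarrow> bool" where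
  "is_critical_value E H a \<longleftrightarrow> (\<exists>u. eikonal_solution E (\<lambda>\<gamma> s p. H \<gamma> s p - a) u)"

end

theory Submission
  imports Defs "HOL-Complex_Analysis.Great_Picard"
begin

text \<open>The argument is compactness plus stability: the functions \<open>u\<^sub>\<lambda>\<close>
are bounded and equicontinuous uniformly in \<open>\<lambda>\<close>, so a subsequence converges
uniformly, and the viscosity inequalities pass to the limit.

Equicontinuity comes from coercivity. At a minimum point of \<open>u\<^sub>\<lambda>\<close> over the
network, constants are admissible test functions from below, also at a vertex, because of the
state constraint; hence \<open>\<lambda> u\<^sub>\<lambda> \<ge> - max H(s, 0)\<close>
(\<open>discounted_lower_bound\<close>). The subsolution inequality then bounds
\<open>H(s, u\<^sub>\<lambda>')\<close> from above, and coercivity makes \<open>u\<^sub>\<lambda>\<close>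
Lipschitz along every arc with one constant (\<open>subsolution_slope_bound\<close>). As finitely
many arcs link any two vertices, the oscillation over the network is bounded as well.

Only the additive constant is left to control, and here the critical value being zero enters
through a comparison of levels (\<open>network_level_comparison\<close>): if a solution on the network
satisfies \<open>H \<le> a\<close> as a subsolution and another satisfies \<open>H \<ge> b\<close> as a
supersolution, then \<open>b \<le> a\<close>. If \<open>u\<^sub>\<lambda>\<close> were positive everywhere, it
would be a subsolution at a negative level, against the supersolution property of an Eikonal solution;
if it were negative everywhere, it would be a supersolution at a positive level, against the
subsolution property. So \<open>u\<^sub>\<lambda>\<close> is nonpositive somewhere and nonnegative somewhere, and the oscillation
bound controls its absolute value.

The comparison looks at a minimum point of the difference on one arc and doubles variables there.
A shifted penalty (\<open>level_comparison_at_minimum\<close>) treats interior points and vertices in the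
same way.\<close>

section \<open>Test functions and slopes of subsolutions\<close>

lemma C1_real_derivative:
  fixes \<phi> D :: "real \<Rightarrow> real"
  assumes "\<And>t. (\<phi> has_real_derivative D t) (at t)" "continuous_on UNIV D"
  shows "\<phi> C1_differentiable_on UNIV" "deriv \<phi> s = D s"
  using assms
  by (auto simp: C1_differentiable_on_def has_real_derivative_iff_has_vector_derivative
           intro: DERIV_imp_deriv)

lemma C1_real_derivativeD:
  fixes \<phi> :: "real \<Rightarrow> real"
  assumes "\<phi> C1_differentiable_on UNIV"
  shows "(\<phi> has_real_derivative deriv \<phi> t) (at t)" "continuous_on UNIV (deriv \<phi>)"
proof -
  obtain D where D: "\<And>x. (\<phi> has_real_derivative D x) (at x)" "continuous_on UNIV D"
    using assms
    by (auto simp: C1_differentiable_on_def has_real_derivative_iff_has_vector_derivative)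
  moreover have "deriv \<phi> = D"
    using C1_real_derivative(2)[OF D] by blast
  ultimately show "(\<phi> has_real_derivative deriv \<phi> t) (at t)" "continuous_on UNIV (deriv \<phi>)"
    by auto
qed

text \<open>Contact with a test function in the form in which it is used throughout: the difference \<open>w - \<phi>\<close>
has a local minimum, without the normalization \<open>\<phi> s = w s\<close>, and the point \<open>s\<close> may be
the end point 1 if the state constraint holds there. Competitors need only range over [0,1].\<close>

lemma supersolution_touch:
  fixes \<phi> D w :: "real \<Rightarrow> real"
  assumes super: "viscosity_supersolution lam h w"
    and s: "0 < s" "s \<le> 1"
    and sc: "s = 1 \<Longrightarrow> state_constraint lam h w"
    and der: "\<And>t. (\<phi> has_real_derivative D t) (at t)" and cont: "continuous_on UNIV D"
    and "0 < \<delta>"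
    and min: "\<And>t. 0 \<le> t \<Longrightarrow> t \<le> 1 \<Longrightarrow> \<bar>t - s\<bar> < \<delta> \<Longrightarrow> w s - \<phi> s \<le> w t - \<phi> t"
  shows "0 \<le> lam * w s + h s (D s)"
proof -
  define \<psi> where "\<psi> t = \<phi> t + (w s - \<phi> s)" for t
  have "(\<psi> has_real_derivative D t) (at t)" for t
    unfolding \<psi>_def using der[of t] by (auto intro!: derivative_eq_intros)
  note \<psi> = C1_real_derivative[OF this cont]
  have \<psi>s: "\<psi> s = w s" by (simp add: \<psi>_def)
  show ?thesis
  proof (cases "s = 1")
    case True
    have "\<forall>t\<in>{1 - min \<delta> 1<..<1}. \<psi> t \<le> w t"
    proof
      fix t assume "t \<in> {1 - min \<delta> 1<..<1}"
      then have "0 \<le> t" "t \<le> 1" "\<bar>t - s\<bar> < \<delta>" using True by (auto simp: min_def split: if_splits)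
      then show "\<psi> t \<le> w t" using min[of t] by (simp add: \<psi>_def)
    qed
    moreover have "min \<delta> 1 > 0" using \<open>0 < \<delta>\<close> by simp
    ultimately have "\<exists>\<delta>>0. \<forall>t\<in>{1 - \<delta><..<1}. \<psi> t \<le> w t" by blast
    then show ?thesis
      using sc[OF True, unfolded state_constraint_def, rule_format, of \<psi>] \<psi> \<psi>s True by auto
  next
    case False
    have "\<forall>\<^sub>F t in nhds s. t \<in> {0<..<1} \<inter> {s - \<delta><..<s + \<delta>}"
      using s False \<open>0 < \<delta>\<close> by (intro eventually_nhds_in_open) auto
    then have "\<forall>\<^sub>F t in nhds s. \<psi> t \<le> w t"
    proof (rule eventually_mono)
      fix t assume t: "t \<in> {0<..<1} \<inter> {s - \<delta><..<s + \<delta>}"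
      then have "\<bar>t - s\<bar> < \<delta>" by auto
      with t show "\<psi> t \<le> w t" using min[of t] by (auto simp: \<psi>_def)
    qed
    moreover have "s \<in> {0<..<1}" using s False by auto
    ultimately show ?thesis
      using super[unfolded viscosity_supersolution_def, rule_format, of s \<psi>] \<psi> \<psi>s by auto
  qed
qed

text \<open>Changing the sign of the unknown exchanges the two halves of the definition of a viscosity solution;
facts about subsolutions in the open interval are obtained from those about supersolutions in this way.\<close>

lemma subsolution_iff_supersolution_uminus:
  "viscosity_subsolution lam h w \<longleftrightarrow>
   viscosity_supersolution lam (\<lambda>s p. - h s (- p)) (\<lambda>t. - w t)"
proof -
  have neg: "(\<lambda>t. - \<phi> t) C1_differentiable_on UNIV" "deriv (\<lambda>t. - \<phi> t) s = - deriv \<phi> s"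
    if "\<phi> C1_differentiable_on UNIV" for \<phi> :: "real \<Rightarrow> real" and s
  proof -
    have "((\<lambda>t. - \<phi> t) has_real_derivative - deriv \<phi> t) (at t)" for t
      using C1_real_derivativeD(1)[OF that, of t] by (rule DERIV_minus)
    moreover have "continuous_on UNIV (\<lambda>t. - deriv \<phi> t)"
      using C1_real_derivativeD(2)[OF that] by (rule continuous_on_minus)
    ultimately show "(\<lambda>t. - \<phi> t) C1_differentiable_on UNIV" "deriv (\<lambda>t. - \<phi> t) s = - deriv \<phi> s"
      by (rule C1_real_derivative)+
  qed
  show ?thesis
  proof
    assume L: "viscosity_subsolution lam h w"
    show "viscosity_supersolution lam (\<lambda>s p. - h s (- p)) (\<lambda>t. - w t)"
      unfolding viscosity_supersolution_def
    proof (intro allI ballI impI, elim conjE)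
      fix \<phi> :: "real \<Rightarrow> real" and s :: real
      assume s: "s \<in> {0<..<1}" and \<phi>: "\<phi> C1_differentiable_on UNIV" "\<phi> s = - w s"
        "\<forall>\<^sub>F t in nhds s. \<phi> t \<le> - w t"
      have "\<forall>\<^sub>F t in nhds s. w t \<le> - \<phi> t"
        using \<phi>(3) by (rule eventually_mono) simp
      moreover have "- \<phi> s = w s" using \<phi>(2) by simp
      ultimately have "lam * (- \<phi> s) + h s (deriv (\<lambda>t. - \<phi> t) s) \<le> 0"
        using L[unfolded viscosity_subsolution_def, rule_format, OF s, of "\<lambda>t. - \<phi> t"] neg[OF \<phi>(1)]
        by auto
      then show "0 \<le> lam * \<phi> s + - h s (- deriv \<phi> s)" by (simp add: neg[OF \<phi>(1)])
    qed
  next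
    assume R: "viscosity_supersolution lam (\<lambda>s p. - h s (- p)) (\<lambda>t. - w t)"
    show "viscosity_subsolution lam h w"
      unfolding viscosity_subsolution_def
    proof (intro allI ballI impI, elim conjE)
      fix \<phi> :: "real \<Rightarrow> real" and s :: real
      assume s: "s \<in> {0<..<1}" and \<phi>: "\<phi> C1_differentiable_on UNIV" "\<phi> s = w s"
        "\<forall>\<^sub>F t in nhds s. w t \<le> \<phi> t"
      have "\<forall>\<^sub>F t in nhds s. - \<phi> t \<le> - w t"
        using \<phi>(3) by (rule eventually_mono) simp
      moreover have "- \<phi> s = - w s" using \<phi>(2) by simp
      ultimately have "0 \<le> lam * (- \<phi> s) + - h s (- deriv (\<lambda>t. - \<phi> t) s)"
        using R[unfolded viscosity_supersolution_def, rule_format, OF s, of "\<lambda>t. - \<phi> t"] neg[OF \<phi>(1)]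
        by auto
      then show "lam * \<phi> s + h s (deriv \<phi> s) \<le> 0" by (simp add: neg[OF \<phi>(1)])
    qed
  qed
qed

lemma subsolution_touch:
  fixes \<phi> D w :: "real \<Rightarrow> real"
  assumes sub: "viscosity_subsolution lam h w"
    and s: "0 < s" "s < 1"
    and der: "\<And>t. (\<phi> has_real_derivative D t) (at t)" and cont: "continuous_on UNIV D"
    and "0 < \<delta>"
    and max: "\<And>t. 0 \<le> t \<Longrightarrow> t \<le> 1 \<Longrightarrow> \<bar>t - s\<bar> < \<delta> \<Longrightarrow> w t - \<phi> t \<le> w s - \<phi> s"
  shows "lam * w s + h s (D s) \<le> 0"
proof -
  have "0 \<le> lam * (- w s) + - h s (- (- D s))"
  proof (rule supersolution_touch[where w = "\<lambda>t. - w t" and h = "\<lambda>s p. - h s (- p)"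
        and \<phi> = "\<lambda>t. - \<phi> t" and D = "\<lambda>t. - D t"])
    show "viscosity_supersolution lam (\<lambda>s p. - h s (- p)) (\<lambda>t. - w t)"
      using sub subsolution_iff_supersolution_uminus by blast
    show "((\<lambda>t. - \<phi> t) has_real_derivative - D t) (at t)" for t
      using der by (rule DERIV_minus)
    show "continuous_on UNIV (\<lambda>t. - D t)" using cont by (rule continuous_on_minus)
    show "- w s - - \<phi> s \<le> - w t - - \<phi> t" if "0 \<le> t" "t \<le> 1" "\<bar>t - s\<bar> < \<delta>" for t
      using max[OF that] by simp
  qed (use s \<open>0 < \<delta>\<close> in auto)
  then show ?thesis by simp
qed

text \<open>A viscosity form of the mean value inequality. If \<open>w\<close> rose by more than \<open>p * (y - x)\<close>
from \<open>x\<close> to \<open>y\<close>, then \<open>w\<close> minus a function with slope at least \<open>p\<close> would have an interior maximum,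
at which the subsolution inequality contradicts the largeness of \<open>h\<close> at all slopes from \<open>p\<close> on.\<close>

lemma subsolution_slope_bound:
  fixes w :: "real \<Rightarrow> real"
  assumes sub: "viscosity_subsolution lam h w"
    and w: "continuous_on {0..1} w"
    and large: "\<And>s q. 0 < s \<Longrightarrow> s < 1 \<Longrightarrow> p \<le> q \<Longrightarrow> 0 < lam * w s + h s q"
    and xy: "0 \<le> x" "x \<le> y" "y \<le> 1"
  shows "w y - w x \<le> p * (y - x)"
proof -
  have interior: "w y - w x \<le> p * (y - x)" if y: "x < y" "y < 1" for y
  proof (rule ccontr)
    assume neg: "\<not> ?thesis"
    define \<eta> where "\<eta> = (w y - w x - p * (y - x)) / 2"
    have \<eta>: "\<eta> > 0" using neg by (simp add: \<eta>_def)
    define \<rho> where "\<rho> = (1 - x) / (y - x)"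
    have \<rho>: "\<rho> > 1" using y by (simp add: \<rho>_def)
    obtain n where n: "(w 1 - w x - p * (1 - x)) / \<eta> < \<rho> ^ n"
      using real_arch_pow[OF \<rho>] by blast
    have "\<rho> ^ n \<le> \<rho> ^ Suc n" using \<rho> by (intro power_increasing) auto
    with n have "(w 1 - w x - p * (1 - x)) / \<eta> < \<rho> ^ Suc n" by linarith
    then have n': "w 1 - w x - p * (1 - x) < \<eta> * \<rho> ^ Suc n"
      using \<eta> by (simp add: pos_divide_less_eq mult.commute del: power_Suc)
    \<comment> \<open>The high power adds only \<open>\<eta>\<close>, half of the excess, at \<open>y\<close>, but at 1 it
      outweighs any increase of \<open>w\<close>: the maximum can be at neither end of \<open>{x..1}\<close>.\<close>
    define \<phi> where "\<phi> t = p * (t - x) + \<eta> * ((t - x) / (y - x)) ^ Suc n" for t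
    define D where "D t = p + \<eta> * (real (Suc n) * ((t - x) / (y - x)) ^ n * (1 / (y - x)))" for t
    have der: "(\<phi> has_real_derivative D t) (at t)" for t
      unfolding \<phi>_def D_def using y by (auto intro!: derivative_eq_intros simp del: power_Suc)
    have D: "continuous_on UNIV D"
      unfolding D_def using y by (auto intro!: continuous_intros)
    have \<phi>: "continuous_on {x..1} \<phi>"
      using der by (meson DERIV_continuous continuous_at_imp_continuous_on)
    have "continuous_on {x..1} w" using w xy by (auto elim: continuous_on_subset)
    with \<phi> have "continuous_on {x..1} (\<lambda>t. w t - \<phi> t)" by (intro continuous_intros)
    then obtain t where t: "t \<in> {x..1}" "\<And>t'. t' \<in> {x..1} \<Longrightarrow> w t' - \<phi> t' \<le> w t - \<phi> t"
      using continuous_attains_sup[of "{x..1}" "\<lambda>t. w t - \<phi> t"] y by auto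
    have "w x < w y - \<phi> y"
      using y \<eta> by (simp add: \<phi>_def \<eta>_def field_simps)
    with t(2)[of y] y have big: "w x < w t - \<phi> t" by auto
    have "t \<noteq> x" using big by (auto simp: \<phi>_def)
    moreover have "t \<noteq> 1"
      using big n' unfolding \<phi>_def \<rho>_def by auto
    ultimately have t': "x < t" "t < 1" using t(1) by auto
    have "lam * w t + h t (D t) \<le> 0"
    proof (rule subsolution_touch[OF sub _ _ der D, of _ "t - x"])
      show "w t' - \<phi> t' \<le> w t - \<phi> t" if "0 \<le> t'" "t' \<le> 1" "\<bar>t' - t\<bar> < t - x" for t'
        using t(2)[of t'] that by auto
    qed (use t' xy in auto)
    moreover have "p \<le> D t" using \<eta> t' y by (simp add: D_def)
    ultimately show False using large[of t "D t"] t' xy by auto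
  qed
  show ?thesis
  proof (cases "x < y")
    case xlty: True
    show ?thesis
    proof (cases "y < 1")
      case False
      with xy have "y = 1" by simp
      have "((\<lambda>t. w t - w x) \<longlongrightarrow> w 1 - w x) (at 1 within {0..1})"
        using w by (auto simp: continuous_on_def intro!: tendsto_intros)
      then have "((\<lambda>t. w t - w x) \<longlongrightarrow> w 1 - w x) (at_left 1)"
        by (simp add: at_within_Icc_at_left)
      moreover have "((\<lambda>t. p * (t - x)) \<longlongrightarrow> p * (1 - x)) (at_left 1)"
        by (intro tendsto_intros)
      moreover have "\<forall>\<^sub>F t in at_left 1. w t - w x \<le> p * (t - x)"
        using eventually_at_left_real[of x 1] xlty \<open>y = 1\<close>
        by (auto elim!: eventually_mono intro: interior)
      ultimately have "w 1 - w x \<le> p * (1 - x)"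
        by (intro tendsto_le[of "at_left (1::real)"]) auto
      then show ?thesis using \<open>y = 1\<close> by simp
    qed (use interior xlty in auto)
  qed (use xy in auto)
qed

section \<open>Comparison of levels on one arc\<close>

text \<open>Bounds on the zero-order term \<open>lam * w\<close> turn a discounted inequality into an Eikonal one at a
constant level, which makes solutions for different discount factors comparable.\<close>

lemma subsolution_level:
  assumes "viscosity_subsolution lam h w" and "\<And>s. 0 < s \<Longrightarrow> s < 1 \<Longrightarrow> - (lam * w s) \<le> a"
  shows "viscosity_subsolution 0 (\<lambda>s p. h s p - a) w"
  unfolding viscosity_subsolution_def
proof (intro allI ballI impI)
  fix \<phi> :: "real \<Rightarrow> real" and s :: real
  assume s: "s \<in> {0<..<1}"
    and \<phi>: "\<phi> C1_differentiable_on UNIV \<and> \<phi> s = w s \<and> (\<forall>\<^sub>F t in nhds s. w t \<le> \<phi> t)"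
  have "lam * \<phi> s + h s (deriv \<phi> s) \<le> 0"
    using assms(1)[unfolded viscosity_subsolution_def, rule_format, OF s \<phi>] .
  then show "0 * \<phi> s + (h s (deriv \<phi> s) - a) \<le> 0"
    using assms(2)[of s] s \<phi> by auto
qed

lemma supersolution_level:
  assumes "viscosity_supersolution lam h w" and "\<And>s. 0 < s \<Longrightarrow> s < 1 \<Longrightarrow> b \<le> - (lam * w s)"
  shows "viscosity_supersolution 0 (\<lambda>s p. h s p - b) w"
  unfolding viscosity_supersolution_def
proof (intro allI ballI impI)
  fix \<phi> :: "real \<Rightarrow> real" and s :: real
  assume s: "s \<in> {0<..<1}"
    and \<phi>: "\<phi> C1_differentiable_on UNIV \<and> \<phi> s = w s \<and> (\<forall>\<^sub>F t in nhds s. \<phi> t \<le> w t)"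
  have "0 \<le> lam * \<phi> s + h s (deriv \<phi> s)"
    using assms(1)[unfolded viscosity_supersolution_def, rule_format, OF s \<phi>] .
  then show "0 \<le> 0 * \<phi> s + (h s (deriv \<phi> s) - b)"
    using assms(2)[of s] s \<phi> by auto
qed

lemma state_constraint_level:
  assumes "state_constraint lam h w" and "b \<le> - (lam * w 1)"
  shows "state_constraint 0 (\<lambda>s p. h s p - b) w"
  unfolding state_constraint_def
proof (intro allI impI)
  fix \<phi> :: "real \<Rightarrow> real"
  assume \<phi>: "\<phi> C1_differentiable_on UNIV \<and> \<phi> 1 = w 1 \<and>
    (\<exists>\<delta>>0. \<forall>t\<in>{1 - \<delta><..<1}. \<phi> t \<le> w t)"
  have "0 \<le> lam * \<phi> 1 + h 1 (deriv \<phi> 1)"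
    using assms(1)[unfolded state_constraint_def, rule_format, OF \<phi>] .
  then show "0 \<le> 0 * \<phi> 1 + (h 1 (deriv \<phi> 1) - b)"
    using assms(2) \<phi> by auto
qed

lemma hamiltonian_tendsto:
  assumes "continuous_on ({0..1} \<times> UNIV) (\<lambda>(s, p). h s p)"
    and "x \<longlonglongrightarrow> s" "\<And>n. x n \<in> {0..1}" "s \<in> {0..1}" "q \<longlonglongrightarrow> p"
  shows "(\<lambda>n. h (x n) (q n)) \<longlonglongrightarrow> (h s p :: real)"
proof -
  have "(\<lambda>n. (x n, q n)) \<longlonglongrightarrow> (s, p)" using assms by (intro tendsto_intros)
  from continuous_on_tendsto_compose[OF assms(1) this] show ?thesis using assms by auto
qed

text \<open>At a minimum point \<open>\<sigma>\<close> of \<open>z - w\<close> the two functions should have a common slope \<open>p\<close>,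
and then \<open>b \<le> h \<sigma> p \<le> a\<close>. As neither function need be differentiable, the
variables are doubled. The penalty \<open>((s - t) / \<epsilon> - 1)\<^sup>2\<close> prefers pairs with
\<open>t = s - \<epsilon>\<close>. The variable \<open>t\<close> of the subsolution, which satisfies
no condition at the end point, is thereby kept away from 1, while \<open>s\<close> may reach 1, where the state
constraint is available.\<close>

lemma level_comparison_at_minimum:
  fixes w z :: "real \<Rightarrow> real"
  assumes cont: "continuous_on ({0..1} \<times> UNIV) (\<lambda>(s, p). h s p)"
    and coercive: "\<And>M. \<exists>R. \<forall>s\<in>{0..1}. \<forall>p. \<bar>p\<bar> \<ge> R \<longrightarrow> h s p \<ge> M"
    and w: "continuous_on {0..1} w" and sub: "viscosity_subsolution 0 (\<lambda>s p. h s p - a) w"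
    and z: "continuous_on {0..1} z" and super: "viscosity_supersolution 0 (\<lambda>s p. h s p - b) z"
    and \<sigma>: "0 < \<sigma>" "\<sigma> \<le> 1"
    and sc: "\<sigma> = 1 \<Longrightarrow> state_constraint 0 (\<lambda>s p. h s p - b) z"
    and min: "\<And>t. t \<in> {0..1} \<Longrightarrow> z \<sigma> - w \<sigma> \<le> z t - w t"
  shows "b \<le> a"
proof (rule ccontr)
  assume "\<not> b \<le> a"
  then have ab: "a < b" by simp
  define \<epsilon> where "\<epsilon> n = \<sigma> / real (Suc n)" for n
  have \<epsilon>_pos: "\<epsilon> n > 0" and \<epsilon>_le: "\<epsilon> n \<le> \<sigma>" for n
    using \<sigma> by (auto simp: \<epsilon>_def field_simps)
  have \<epsilon>_lim: "\<epsilon> \<longlonglongrightarrow> 0"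
    unfolding \<epsilon>_def using LIMSEQ_Suc[OF lim_const_over_n[of \<sigma>]] by simp
  define \<Phi> where "\<Phi> n = (\<lambda>(s, t). z s - w t + ((s - t) / \<epsilon> n - 1)\<^sup>2 + (s - \<sigma>)\<^sup>2)" for n
  have "\<exists>x\<in>{0..1} \<times> {0..1}. \<forall>y\<in>{0..1} \<times> {0..1}. \<Phi> n x \<le> \<Phi> n y" for n
  proof (rule continuous_attains_inf)
    have "continuous_on ({0..1} \<times> {0..1}) (\<lambda>x. z (fst x))" "continuous_on ({0..1} \<times> {0..1}) (\<lambda>x. w (snd x))"
      using z w by (auto intro!: continuous_on_compose2[of "{0..1}" z] continuous_on_compose2[of "{0..1}" w] continuous_intros)
    then show "continuous_on ({0..1} \<times> {0..1}) (\<Phi> n)"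
      unfolding \<Phi>_def case_prod_unfold using \<epsilon>_pos[of n] by (intro continuous_intros) auto
  qed (auto intro: compact_Times)
  then obtain X where X: "\<And>n. X n \<in> {0..1} \<times> {0..1}"
      "\<And>n y. y \<in> {0..1} \<times> {0..1} \<Longrightarrow> \<Phi> n (X n) \<le> \<Phi> n y"
    by metis
  define s where "s n = fst (X n)" for n
  define t where "t n = snd (X n)" for n
  define d where "d n = (s n - t n) / \<epsilon> n - 1" for n
  have st: "s n \<in> {0..1}" "t n \<in> {0..1}" for n
    using X(1)[of n] by (auto simp: s_def t_def mem_Times_iff)
  have minimal: "z (s n) - w (t n) + (d n)\<^sup>2 + (s n - \<sigma>)\<^sup>2
      \<le> z s' - w t' + ((s' - t') / \<epsilon> n - 1)\<^sup>2 + (s' - \<sigma>)\<^sup>2"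
    if "s' \<in> {0..1}" "t' \<in> {0..1}" for n s' t'
    using X(2)[of "(s', t')" n] that
    by (simp add: \<Phi>_def case_prod_unfold s_def t_def d_def)
  \<comment> \<open>The competitor \<open>(\<sigma>, \<sigma> - \<epsilon> n)\<close> makes both penalties vanish; minimality of \<open>\<sigma>\<close>
    cancels the values of \<open>z\<close>.\<close>
  have key: "(d n)\<^sup>2 + (s n - \<sigma>)\<^sup>2 \<le> (w \<sigma> - w (\<sigma> - \<epsilon> n)) + (w (t n) - w (s n))" for n
    using minimal[of \<sigma> "\<sigma> - \<epsilon> n" n] min[OF st(1)[of n]] \<epsilon>_pos[of n] \<epsilon>_le[of n] \<sigma> by auto
  have "bounded (w ` {0..1})"
    by (rule compact_imp_bounded[OF compact_continuous_image[OF w compact_Icc]])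
  then obtain B where "\<forall>y\<in>w ` {0..1}. norm y \<le> B" unfolding bounded_iff by blast
  then have B: "\<bar>w t\<bar> \<le> B" if "t \<in> {0..1}" for t using that by simp
  have d_sq: "(d n)\<^sup>2 \<le> 4 * B" for n
  proof -
    have "\<bar>w \<sigma>\<bar> \<le> B" "\<bar>w (\<sigma> - \<epsilon> n)\<bar> \<le> B" "\<bar>w (t n)\<bar> \<le> B" "\<bar>w (s n)\<bar> \<le> B"
      using B[of \<sigma>] B[of "\<sigma> - \<epsilon> n"] B[OF st(1)] B[OF st(2)] \<epsilon>_pos[of n] \<epsilon>_le[of n] \<sigma> by auto
    then show ?thesis using key[of n] zero_le_power2[of "s n - \<sigma>"] by linarith
  qed
  \<comment> \<open>A crude bound on the penalty gives \<open>s n - t n \<longlonglongrightarrow> 0\<close>; with it, the right-hand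
    side of \<open>key\<close> tends to 0, and so do the penalties.\<close>
  have st_lim: "(\<lambda>n. s n - t n) \<longlonglongrightarrow> 0"
  proof (rule Lim_null_comparison)
    show "(\<lambda>n. \<epsilon> n * (sqrt (4 * B) + 1)) \<longlonglongrightarrow> 0"
      using tendsto_mult_right[OF \<epsilon>_lim, of "sqrt (4 * B) + 1"] by simp
    have "norm (s n - t n) \<le> \<epsilon> n * (sqrt (4 * B) + 1)" for n
    proof -
      have "\<bar>d n\<bar> \<le> sqrt (4 * B)"
        using real_sqrt_le_mono[OF d_sq[of n]] by simp
      then have "\<bar>d n + 1\<bar> \<le> sqrt (4 * B) + 1" by linarith
      moreover have "s n - t n = \<epsilon> n * (d n + 1)"
        using \<epsilon>_pos[of n] by (simp add: d_def)
      ultimately show ?thesis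
        using \<epsilon>_pos[of n] by (simp add: abs_mult)
    qed
    then show "\<forall>\<^sub>F n in sequentially. norm (s n - t n) \<le> \<epsilon> n * (sqrt (4 * B) + 1)" by simp
  qed
  have "uniformly_continuous_on {0..1} w"
    by (rule compact_uniformly_continuous[OF w compact_Icc])
  then have "(\<lambda>n. dist (w (t n)) (w (s n))) \<longlonglongrightarrow> 0"
    using st st_lim unfolding uniformly_continuous_on_sequentially
    by (auto simp: dist_real_def abs_minus_commute tendsto_rabs_zero_iff)
  then have "(\<lambda>n. w (t n) - w (s n)) \<longlonglongrightarrow> 0"
    by (simp add: dist_real_def tendsto_rabs_zero_iff)
  moreover have "(\<lambda>n. w (\<sigma> - \<epsilon> n)) \<longlonglongrightarrow> w \<sigma>"
  proof (rule continuous_on_tendsto_compose[OF w])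
    show "(\<lambda>n. \<sigma> - \<epsilon> n) \<longlonglongrightarrow> \<sigma>" using tendsto_diff[OF tendsto_const \<epsilon>_lim] by simp
    show "\<forall>\<^sub>F n in sequentially. \<sigma> - \<epsilon> n \<in> {0..1}"
    proof (intro always_eventually allI)
      show "\<sigma> - \<epsilon> n \<in> {0..1}" for n using \<epsilon>_pos[of n] \<epsilon>_le[of n] \<sigma> by auto
    qed
  qed (use \<sigma> in auto)
  ultimately have rhs: "(\<lambda>n. (w \<sigma> - w (\<sigma> - \<epsilon> n)) + (w (t n) - w (s n))) \<longlonglongrightarrow> (w \<sigma> - w \<sigma>) + 0"
    by (intro tendsto_intros)
  have sq_zero: "f \<longlonglongrightarrow> 0" if f: "\<And>n. (f n)\<^sup>2 \<le> (d n)\<^sup>2 + (s n - \<sigma>)\<^sup>2" for f :: "nat \<Rightarrow> real"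
  proof -
    have "(\<lambda>n. (f n)\<^sup>2) \<longlonglongrightarrow> 0"
    proof (rule tendsto_sandwich[OF _ _ tendsto_const])
      show "(\<lambda>n. (w \<sigma> - w (\<sigma> - \<epsilon> n)) + (w (t n) - w (s n))) \<longlonglongrightarrow> 0" using rhs by simp
    qed (use f key in \<open>auto intro!: always_eventually order_trans[OF f key]\<close>)
    then show ?thesis by simp
  qed
  have d_lim: "d \<longlonglongrightarrow> 0" by (rule sq_zero) simp
  have "(\<lambda>n. s n - \<sigma>) \<longlonglongrightarrow> 0" by (rule sq_zero) simp
  then have s_lim: "s \<longlonglongrightarrow> \<sigma>" by (simp add: LIM_zero_iff)
  have t_lim: "t \<longlonglongrightarrow> \<sigma>" using tendsto_diff[OF s_lim st_lim] by simp
  \<comment> \<open>The condition \<open>- 1 < d n\<close> says \<open>t n < s n\<close>, so that \<open>t n\<close> is interior.\<close>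
  have "\<forall>\<^sub>F n in sequentially. 0 < s n \<and> 0 < t n \<and> - 1 < d n \<and> (\<sigma> < 1 \<longrightarrow> s n < 1)"
    using order_tendstoD(1)[OF s_lim] order_tendstoD(1)[OF t_lim] order_tendstoD(1)[OF d_lim, of "-1"]
      order_tendstoD(2)[OF s_lim, of 1] \<sigma>
    by (cases "\<sigma> < 1") (auto intro!: eventually_conj)
  then obtain N where N: "\<And>n. n \<ge> N \<Longrightarrow> 0 < s n \<and> 0 < t n \<and> - 1 < d n \<and> (\<sigma> < 1 \<longrightarrow> s n < 1)"
    unfolding eventually_sequentially by blast
  \<comment> \<open>The slope common to both test functions, up to the vanishing correction from
    \<open>(s - \<sigma>)\<^sup>2\<close>.\<close>
  define q where "q n = - 2 * d n / \<epsilon> n" for n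
  have h_sub: "h (t n) (q n) \<le> a" if "n \<ge> N" for n
  proof -
    have "0 < s n - t n"
      using N[OF that] \<epsilon>_pos[of n] by (simp add: d_def field_simps)
    then have t1: "t n < 1" using st(1)[of n] by auto
    have "0 * w (t n) + (h (t n) (2 * ((s n - t n) / \<epsilon> n - 1) * (- 1 / \<epsilon> n)) - a) \<le> 0"
    proof (rule subsolution_touch[OF sub, where \<delta> = 1 and \<phi> = "\<lambda>t. ((s n - t) / \<epsilon> n - 1)\<^sup>2"])
      show "((\<lambda>t. ((s n - t) / \<epsilon> n - 1)\<^sup>2) has_real_derivative
          2 * ((s n - t') / \<epsilon> n - 1) * (- 1 / \<epsilon> n)) (at t')" for t'
        using \<epsilon>_pos[of n] by (auto intro!: derivative_eq_intros)
      show "continuous_on UNIV (\<lambda>t'. 2 * ((s n - t') / \<epsilon> n - 1) * (- 1 / \<epsilon> n))"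
        using \<epsilon>_pos[of n] by (auto intro!: continuous_intros)
      show "w t' - ((s n - t') / \<epsilon> n - 1)\<^sup>2 \<le> w (t n) - ((s n - t n) / \<epsilon> n - 1)\<^sup>2"
        if "0 \<le> t'" "t' \<le> 1" for t'
        using minimal[OF st(1)[of n], of t' n] that by (auto simp: d_def)
    qed (use N[OF that] t1 in auto)
    then show ?thesis unfolding d_def[symmetric] by (simp add: q_def)
  qed
  have h_super: "b \<le> h (s n) (q n - 2 * (s n - \<sigma>))" if "n \<ge> N" for n
  proof -
    have "0 \<le> 0 * z (s n) + (h (s n) (- (2 * ((s n - t n) / \<epsilon> n - 1) * (1 / \<epsilon> n)) - 2 * (s n - \<sigma>)) - b)"
    proof (rule supersolution_touch[OF super, where \<delta> = 1
          and \<phi> = "\<lambda>s. - (((s - t n) / \<epsilon> n - 1)\<^sup>2) - (s - \<sigma>)\<^sup>2"])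
      show "state_constraint 0 (\<lambda>s p. h s p - b) z" if "s n = 1"
        using sc N[OF \<open>n \<ge> N\<close>] that \<sigma> by force
      show "((\<lambda>s. - (((s - t n) / \<epsilon> n - 1)\<^sup>2) - (s - \<sigma>)\<^sup>2) has_real_derivative
          - (2 * ((s' - t n) / \<epsilon> n - 1) * (1 / \<epsilon> n)) - 2 * (s' - \<sigma>)) (at s')" for s'
        using \<epsilon>_pos[of n] by (auto intro!: derivative_eq_intros)
      show "continuous_on UNIV (\<lambda>s'. - (2 * ((s' - t n) / \<epsilon> n - 1) * (1 / \<epsilon> n)) - 2 * (s' - \<sigma>))"
        using \<epsilon>_pos[of n] by (auto intro!: continuous_intros)
      show "z (s n) - (- (((s n - t n) / \<epsilon> n - 1)\<^sup>2) - (s n - \<sigma>)\<^sup>2)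
          \<le> z s' - (- (((s' - t n) / \<epsilon> n - 1)\<^sup>2) - (s' - \<sigma>)\<^sup>2)" if "0 \<le> s'" "s' \<le> 1" for s'
        using minimal[OF _ st(2)[of n], of s' n] that by (auto simp: d_def)
    qed (use N[OF that] st(1)[of n] in auto)
    then show ?thesis unfolding d_def[symmetric] by (simp add: q_def)
  qed
  obtain R where R: "\<And>s p. s \<in> {0..1} \<Longrightarrow> \<bar>p\<bar> \<ge> R \<Longrightarrow> h s p \<ge> a + 1"
    using coercive[of "a + 1"] by blast
  \<comment> \<open>The subsolution inequality and coercivity bound the slopes, so they have a limit point.\<close>
  have "q (n + N) \<in> {- R..R}" for n
    using R[OF st(2), of "q (n + N)" "n + N"] h_sub[of "n + N"] by fastforce
  then obtain p r where r: "strict_mono r" "((\<lambda>n. q (n + N)) \<circ> r) \<longlonglongrightarrow> p"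
    using compact_Icc[of "- R" R] unfolding compact_def by metis
  have shift: "(\<lambda>n. x (r n + N)) \<longlonglongrightarrow> l" if "x \<longlonglongrightarrow> l" for x and l :: real
    using LIMSEQ_subseq_LIMSEQ[OF LIMSEQ_ignore_initial_segment[OF that, of N] r(1)] by (simp add: o_def)
  have q_lim: "(\<lambda>n. q (r n + N)) \<longlonglongrightarrow> p" using r(2) by (simp add: o_def)
  have "(\<lambda>n. h (t (r n + N)) (q (r n + N))) \<longlonglongrightarrow> h \<sigma> p"
    using \<sigma> st by (intro hamiltonian_tendsto[OF cont] shift t_lim q_lim) auto
  then have "h \<sigma> p \<le> a"
    by (rule LIMSEQ_le_const2) (use h_sub in auto)
  have "(\<lambda>n. q (r n + N) - 2 * (s (r n + N) - \<sigma>)) \<longlonglongrightarrow> p - 2 * (\<sigma> - \<sigma>)"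
    by (intro tendsto_intros q_lim shift s_lim)
  then have slope_lim: "(\<lambda>n. q (r n + N) - 2 * (s (r n + N) - \<sigma>)) \<longlonglongrightarrow> p" by simp
  have "(\<lambda>n. h (s (r n + N)) (q (r n + N) - 2 * (s (r n + N) - \<sigma>))) \<longlonglongrightarrow> h \<sigma> p"
    by (rule hamiltonian_tendsto[OF cont shift[OF s_lim] st(1) _ slope_lim]) (use \<sigma> in auto)
  then have "b \<le> h \<sigma> p"
    by (rule LIMSEQ_le_const) (use h_super in auto)
  with \<open>h \<sigma> p \<le> a\<close> ab show False by simp
qed

section \<open>Stability under uniform convergence\<close>

text \<open>Subtracting \<open>(t - s)\<^sup>2\<close> makes the contact at \<open>s\<close> strict, so that minimum points of
\<open>f n - \<phi> + (t - s)\<^sup>2\<close> near \<open>s\<close> converge to \<open>s\<close>. For \<open>s = 1\<close> these minimum points may be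
1 or interior; the state constraint covers the first case and the interior inequality
the second, which is why both kinds of contact are treated together.\<close>

lemma supersolution_limit_touch:
  fixes f :: "nat \<Rightarrow> real \<Rightarrow> real"
  assumes cont: "continuous_on ({0..1} \<times> UNIV) (\<lambda>(s, p). h s p)"
    and f: "\<And>n. continuous_on {0..1} (f n)" and lim: "uniform_limit {0..1} f v sequentially"
    and \<mu>: "\<mu> \<longlonglongrightarrow> lam"
    and super: "\<And>n. viscosity_supersolution (\<mu> n) h (f n)"
    and s: "0 < s" "s \<le> 1" and sc: "\<And>n. s = 1 \<Longrightarrow> state_constraint (\<mu> n) h (f n)"
    and der: "\<And>t. (\<phi> has_real_derivative D t) (at t)" and D: "continuous_on UNIV D"
    and \<delta>: "0 < \<delta>" and touch: "\<phi> s = v s"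
    and below: "\<And>t. 0 \<le> t \<Longrightarrow> t \<le> 1 \<Longrightarrow> \<bar>t - s\<bar> < \<delta> \<Longrightarrow> \<phi> t \<le> v t"
  shows "0 \<le> lam * v s + h s (D s)"
proof -
  \<comment> \<open>Half the radius leaves room: the minimum over \<open>I\<close> is a local minimum relative to \<open>{0..1}\<close>
    once the minimum point is within \<open>\<delta> / 4\<close> of \<open>s\<close>.\<close>
  define I where "I = {0..1} \<inter> {s - \<delta> / 2..s + \<delta> / 2}"
  have "compact I" "I \<subseteq> {0..1}" "s \<in> I"
    using s \<delta> by (auto simp: I_def)
  have \<phi>: "continuous_on I \<phi>"
    using der by (meson DERIV_continuous continuous_at_imp_continuous_on)
  have "\<exists>x\<in>I. \<forall>t\<in>I. f n x - (\<phi> x - (x - s)\<^sup>2) \<le> f n t - (\<phi> t - (t - s)\<^sup>2)" for n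
    using \<open>s \<in> I\<close> continuous_on_subset[OF f \<open>I \<subseteq> {0..1}\<close>, of n] \<phi>
    by (intro continuous_attains_inf \<open>compact I\<close>) (auto intro!: continuous_intros)
  then obtain x where x: "\<And>n. x n \<in> I"
      "\<And>n t. t \<in> I \<Longrightarrow> f n (x n) - (\<phi> (x n) - (x n - s)\<^sup>2) \<le> f n t - (\<phi> t - (t - s)\<^sup>2)"
    by metis
  have x01: "x n \<in> {0..1}" for n using x(1) \<open>I \<subseteq> {0..1}\<close> by blast
  have diff: "(\<lambda>n. f n (y n) - v (y n)) \<longlonglongrightarrow> 0" if "\<And>n. y n \<in> {0..1}" for y
  proof (rule tendstoI)
    fix e :: real assume "e > 0"
    from uniform_limitD[OF lim this]
    show "\<forall>\<^sub>F n in sequentially. dist (f n (y n) - v (y n)) 0 < e"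
      by (rule eventually_mono) (use that in \<open>auto simp: dist_real_def\<close>)
  qed
  have "(x n - s)\<^sup>2 \<le> (f n s - v s) - (f n (x n) - v (x n))" for n
  proof -
    have "\<phi> (x n) \<le> v (x n)"
    proof (rule below)
      show "\<bar>x n - s\<bar> < \<delta>" using x(1)[of n] \<delta> by (auto simp: I_def)
    qed (use x01[of n] in auto)
    then show ?thesis using x(2)[OF \<open>s \<in> I\<close>, of n] touch by simp
  qed
  note sq = this
  have "(\<lambda>n. (f n s - v s) - (f n (x n) - v (x n))) \<longlonglongrightarrow> 0 - 0"
    using s by (intro tendsto_diff diff x01) auto
  then have bound: "(\<lambda>n. (f n s - v s) - (f n (x n) - v (x n))) \<longlonglongrightarrow> 0" by simp
  have "(\<lambda>n. (x n - s)\<^sup>2) \<longlonglongrightarrow> 0"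
    by (rule tendsto_sandwich[OF _ _ tendsto_const bound]) (use sq in auto)
  then have "(\<lambda>n. x n - s) \<longlonglongrightarrow> 0" by simp
  then have x_lim: "x \<longlonglongrightarrow> s" by (simp add: LIM_zero_iff)
  have v: "continuous_on {0..1} v"
    by (rule uniform_limit_theorem[OF always_eventually lim]) (use f in auto)
  have "(\<lambda>n. v (x n)) \<longlonglongrightarrow> v s"
    by (rule continuous_on_tendsto_compose[OF v x_lim]) (use s x01 in auto)
  from tendsto_add[OF diff[of x, OF x01] this] have fx: "(\<lambda>n. f n (x n)) \<longlonglongrightarrow> v s" by simp
  have D_lim: "(\<lambda>n. D (x n)) \<longlonglongrightarrow> D s"
    by (rule continuous_on_tendsto_compose[OF D x_lim]) auto
  have "(\<lambda>n. D (x n) - 2 * (x n - s)) \<longlonglongrightarrow> D s - 2 * (s - s)"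
    by (intro tendsto_intros D_lim x_lim)
  then have "(\<lambda>n. h (x n) (D (x n) - 2 * (x n - s))) \<longlonglongrightarrow> h s (D s)"
    using s x01 by (intro hamiltonian_tendsto[OF cont] x_lim) auto
  then have "(\<lambda>n. \<mu> n * f n (x n) + h (x n) (D (x n) - 2 * (x n - s))) \<longlonglongrightarrow> lam * v s + h s (D s)"
    by (intro tendsto_intros \<mu> fx)
  moreover have "\<forall>\<^sub>F n in sequentially. 0 \<le> \<mu> n * f n (x n) + h (x n) (D (x n) - 2 * (x n - s))"
  proof -
    have "\<forall>\<^sub>F n in sequentially. \<bar>x n - s\<bar> < \<delta> / 4"
      using tendstoD[OF x_lim, of "\<delta> / 4"] \<delta> by (simp add: dist_real_def)
    moreover have "\<forall>\<^sub>F n in sequentially. 0 < x n" using order_tendstoD(1)[OF x_lim] s by simp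
    moreover have "\<forall>\<^sub>F n in sequentially. s < 1 \<longrightarrow> x n < 1"
      using order_tendstoD(2)[OF x_lim, of 1] by (cases "s < 1") auto
    ultimately show ?thesis
    proof eventually_elim
      case (elim n)
      show ?case
      proof (rule supersolution_touch[OF super, where \<phi> = "\<lambda>t. \<phi> t - (t - s)\<^sup>2" and \<delta> = "\<delta> / 4"])
        show "state_constraint (\<mu> n) h (f n)" if "x n = 1" using sc elim that s by force
        show "((\<lambda>t. \<phi> t - (t - s)\<^sup>2) has_real_derivative D t - 2 * (t - s)) (at t)" for t
          using der[of t] by (auto intro!: derivative_eq_intros)
        show "continuous_on UNIV (\<lambda>t. D t - 2 * (t - s))" using D by (intro continuous_intros)
        show "f n (x n) - (\<phi> (x n) - (x n - s)\<^sup>2) \<le> f n t - (\<phi> t - (t - s)\<^sup>2)"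
          if "0 \<le> t" "t \<le> 1" "\<bar>t - x n\<bar> < \<delta> / 4" for t
        proof (rule x(2))
          have "\<bar>t - s\<bar> \<le> \<delta> / 2" using that(3) elim(1) by (simp add: abs_if split: if_splits)
          then have "- (\<delta> / 2) \<le> t - s" "t - s \<le> \<delta> / 2" by linarith+
          then show "t \<in> I" using that(1,2) by (simp add: I_def)
        qed
      qed (use elim x01[of n] \<delta> in auto)
    qed
  qed
  ultimately show ?thesis by (rule tendsto_lowerbound) simp
qed

lemma supersolution_limit:
  fixes f :: "nat \<Rightarrow> real \<Rightarrow> real"
  assumes "continuous_on ({0..1} \<times> UNIV) (\<lambda>(s, p). h s p)"
    and "\<And>n. continuous_on {0..1} (f n)" and "uniform_limit {0..1} f v sequentially"
    and "\<mu> \<longlonglongrightarrow> lam"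
    and "\<And>n. viscosity_supersolution (\<mu> n) h (f n)"
  shows "viscosity_supersolution lam h v"
  unfolding viscosity_supersolution_def
proof (intro allI ballI impI, elim conjE)
  fix \<phi> :: "real \<Rightarrow> real" and s :: real
  assume s: "s \<in> {0<..<1}" and \<phi>: "\<phi> C1_differentiable_on UNIV" "\<phi> s = v s"
    and ev: "\<forall>\<^sub>F t in nhds s. \<phi> t \<le> v t"
  obtain \<delta> where \<delta>: "\<delta> > 0" "\<And>t. dist t s < \<delta> \<Longrightarrow> \<phi> t \<le> v t"
    using ev unfolding eventually_nhds_metric by blast
  show "0 \<le> lam * \<phi> s + h s (deriv \<phi> s)"
    unfolding \<phi>(2)
    by (rule supersolution_limit_touch[OF assms, where \<phi> = \<phi> and \<delta> = \<delta>])
      (use s \<phi> \<delta> C1_real_derivativeD in \<open>auto simp: dist_real_def\<close>)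
qed

lemma subsolution_limit:
  fixes f :: "nat \<Rightarrow> real \<Rightarrow> real"
  assumes h: "continuous_on ({0..1} \<times> UNIV) (\<lambda>(s, p). h s p)"
    and f: "\<And>n. continuous_on {0..1} (f n)" and lim: "uniform_limit {0..1} f v sequentially"
    and \<mu>: "\<mu> \<longlonglongrightarrow> lam"
    and sub: "\<And>n. viscosity_subsolution (\<mu> n) h (f n)"
  shows "viscosity_subsolution lam h v"
  unfolding subsolution_iff_supersolution_uminus
proof (rule supersolution_limit[OF _ _ _ \<mu>])
  have "continuous_on ({0..1} \<times> UNIV) (\<lambda>x. (\<lambda>(s, p). h s p) (fst x, - snd x))"
    by (rule continuous_on_compose2[OF h]) (auto intro!: continuous_intros)
  then show "continuous_on ({0..1} \<times> UNIV) (\<lambda>(s, p). - h s (- p))"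
    unfolding case_prod_unfold by (simp add: continuous_on_minus)
  show "continuous_on {0..1} (\<lambda>t. - f n t)" for n using f by (rule continuous_on_minus)
  show "uniform_limit {0..1} (\<lambda>n t. - f n t) (\<lambda>t. - v t) sequentially"
    using lim by (rule uniform_limit_uminus)
  show "viscosity_supersolution (\<mu> n) (\<lambda>s p. - h s (- p)) (\<lambda>t. - f n t)" for n
    using sub subsolution_iff_supersolution_uminus by blast
qed

lemma state_constraint_limit:
  fixes f :: "nat \<Rightarrow> real \<Rightarrow> real"
  assumes "continuous_on ({0..1} \<times> UNIV) (\<lambda>(s, p). h s p)"
    and "\<And>n. continuous_on {0..1} (f n)" and "uniform_limit {0..1} f v sequentially"
    and "\<mu> \<longlonglongrightarrow> lam"
    and "\<And>n. viscosity_supersolution (\<mu> n) h (f n)" and sc: "\<And>n. state_constraint (\<mu> n) h (f n)"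
  shows "state_constraint lam h v"
  unfolding state_constraint_def
proof (intro allI impI, elim conjE exE)
  fix \<phi> :: "real \<Rightarrow> real" and \<delta> :: real
  assume \<phi>: "\<phi> C1_differentiable_on UNIV" "\<phi> 1 = v 1"
    and \<delta>: "\<delta> > 0" "\<forall>t\<in>{1 - \<delta><..<1}. \<phi> t \<le> v t"
  have below: "\<phi> t \<le> v t" if "t \<le> 1" "\<bar>t - 1\<bar> < \<delta>" for t
    using \<delta>(2) \<phi>(2) that by (cases "t = 1") auto
  show "0 \<le> lam * \<phi> 1 + h 1 (deriv \<phi> 1)"
    unfolding \<phi>(2)
    by (rule supersolution_limit_touch[OF assms(1-5), where \<phi> = \<phi> and \<delta> = \<delta>])
      (use \<phi> \<delta>(1) sc below C1_real_derivativeD in auto)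
qed

section \<open>Comparison on the network\<close>

lemma finite_uniform_bound:
  fixes Q :: "'b \<Rightarrow> real \<Rightarrow> bool"
  assumes "finite A" and "\<And>a. a \<in> A \<Longrightarrow> \<exists>K. Q a K"
    and mono: "\<And>a K K'. Q a K \<Longrightarrow> K \<le> K' \<Longrightarrow> Q a K'"
  shows "\<exists>K. \<forall>a\<in>A. Q a K"
  using assms(1,2)
proof (induction A)
  case (insert a A)
  then obtain K K' where "\<forall>a\<in>A. Q a K" "Q a K'" by (metis insert_iff)
  then have "\<forall>b\<in>insert a A. Q b (max K K')" using mono by (metis insert_iff max.cobounded1 max.cobounded2)
  then show ?case by blast
qed simp

lemma network_arcD:
  assumes "network E" "\<gamma> \<in> E"
  shows "continuous_on {0..1} \<gamma>" "reversepath \<gamma> \<in> E" "\<gamma> ` {0..1} \<subseteq> net_support E"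
    "pathstart \<gamma> \<in> net_vertices E" "pathfinish \<gamma> \<in> net_vertices E"
  using assms unfolding network_def net_support_def net_vertices_def
  by (auto simp: path_image_def simple_path_def path_def)

lemma network_hamiltonianD:
  assumes "network_hamiltonian E H" "\<gamma> \<in> E"
  shows "continuous_on ({0..1} \<times> UNIV) (\<lambda>(s, p). H \<gamma> s p)"
    "\<exists>R. \<forall>s\<in>{0..1}. \<forall>p. \<bar>p\<bar> \<ge> R \<longrightarrow> H \<gamma> s p \<ge> M"
  using assms unfolding network_hamiltonian_def hamiltonian_def by auto

lemma network_solutionD:
  assumes "network_solution E H l u" "\<gamma> \<in> E"
  shows "continuous_on {0..1} (u \<circ> \<gamma>)" "viscosity_subsolution l (H \<gamma>) (u \<circ> \<gamma>)"
    "viscosity_supersolution l (H \<gamma>) (u \<circ> \<gamma>)"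
  using assms unfolding network_solution_def viscosity_solution_def by auto

lemma compact_net_support:
  assumes "network E"
  shows "compact (net_support E)"
proof -
  have "compact (path_image \<gamma>)" if "\<gamma> \<in> E" for \<gamma>
    unfolding path_image_def
    using network_arcD(1)[OF assms that] by (intro compact_continuous_image) auto
  moreover have "finite E" using assms by (simp add: network_def)
  ultimately show ?thesis unfolding net_support_def by (intro compact_UN) auto
qed

text \<open>Every point lies on an arc at a parameter where supersolution tests are available: an interior
parameter, or the final one of an arc singled out by the vertex condition. With \<open>P\<close> the state
constraint, minimum points over the network need no case distinction.\<close>

lemma arc_through_point:
  assumes x: "x \<in> net_support E"
    and vertex: "\<forall>y\<in>net_vertices E. \<exists>\<gamma>\<in>E. pathfinish \<gamma> = y \<and> P \<gamma>"
  obtains \<gamma> \<sigma> where "\<gamma> \<in> E" "0 < \<sigma>" "\<sigma> \<le> 1" "\<gamma> \<sigma> = x" "\<sigma> = 1 \<Longrightarrow> P \<gamma>"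
proof -
  obtain \<gamma> \<sigma> where \<gamma>: "\<gamma> \<in> E" "\<sigma> \<in> {0..1}" "x = \<gamma> \<sigma>"
    using x by (auto simp: net_support_def path_image_def)
  show ?thesis
  proof (cases "0 < \<sigma> \<and> \<sigma> < 1")
    case True
    then show ?thesis using that \<gamma> by auto
  next
    case False
    then have "\<sigma> = 0 \<or> \<sigma> = 1" using \<gamma> by auto
    then have "x \<in> net_vertices E"
      using \<gamma> by (auto simp: net_vertices_def pathstart_def pathfinish_def)
    then obtain \<gamma>' where "\<gamma>' \<in> E" "\<gamma>' 1 = x" "P \<gamma>'"
      using vertex by (auto simp: pathfinish_def)
    then show ?thesis using that[of \<gamma>' 1] by auto
  qed
qed

text \<open>A minimum point of \<open>v - u\<close> over the compact network lies on an arc along which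
the one-dimensional comparison applies. The subsolution \<open>u\<close> enters with any arc through this point, so the
arc can be chosen as the state constraint of \<open>v\<close> requires.\<close>

lemma network_level_comparison:
  assumes net: "network E" and ham: "network_hamiltonian E H" and "E \<noteq> {}"
    and u: "network_solution E H l u" and v: "network_solution E H m v"
    and a: "\<And>x. x \<in> net_support E \<Longrightarrow> - (l * u x) \<le> a"
    and b: "\<And>x. x \<in> net_support E \<Longrightarrow> b \<le> - (m * v x)"
  shows "b \<le> a"
proof -
  have "net_support E \<noteq> {}" using \<open>E \<noteq> {}\<close> by (auto simp: net_support_def)
  moreover have "continuous_on (net_support E) (\<lambda>x. v x - u x)"
    using u v by (auto simp: network_solution_def intro: continuous_on_diff)
  ultimately obtain x where x: "x \<in> net_support E"
      "\<And>y. y \<in> net_support E \<Longrightarrow> v x - u x \<le> v y - u y"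
    using continuous_attains_inf[OF compact_net_support[OF net]] by blast
  obtain \<gamma> \<sigma> where \<gamma>: "\<gamma> \<in> E" "0 < \<sigma>" "\<sigma> \<le> 1" "\<gamma> \<sigma> = x"
      and sc: "\<sigma> = 1 \<Longrightarrow> state_constraint m (H \<gamma>) (v \<circ> \<gamma>)"
    using arc_through_point[OF x(1), of "\<lambda>\<gamma>. state_constraint m (H \<gamma>) (v \<circ> \<gamma>)"] v
    unfolding network_solution_def by blast
  have supp: "\<gamma> t \<in> net_support E" if "0 \<le> t" "t \<le> 1" for t
    using network_arcD(3)[OF net \<gamma>(1)] that by auto
  show ?thesis
  proof (rule level_comparison_at_minimum[where h = "H \<gamma>" and w = "u \<circ> \<gamma>" and z = "v \<circ> \<gamma>" and \<sigma> = \<sigma>])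
    show "viscosity_subsolution 0 (\<lambda>s p. H \<gamma> s p - a) (u \<circ> \<gamma>)"
      by (rule subsolution_level[OF network_solutionD(2)[OF u \<gamma>(1)]]) (simp add: a supp)
    show "viscosity_supersolution 0 (\<lambda>s p. H \<gamma> s p - b) (v \<circ> \<gamma>)"
      by (rule supersolution_level[OF network_solutionD(3)[OF v \<gamma>(1)]]) (simp add: b supp)
    show "state_constraint 0 (\<lambda>s p. H \<gamma> s p - b) (v \<circ> \<gamma>)" if "\<sigma> = 1"
      by (rule state_constraint_level[OF sc[OF that]]) (simp add: b supp)
    show "(v \<circ> \<gamma>) \<sigma> - (u \<circ> \<gamma>) \<sigma> \<le> (v \<circ> \<gamma>) t - (u \<circ> \<gamma>) t" if "t \<in> {0..1}" for t
      using x(2)[OF supp, of t] that \<gamma>(4) by auto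
  qed (use \<gamma> network_hamiltonianD[OF ham \<gamma>(1)] network_solutionD(1)[OF u \<gamma>(1)]
        network_solutionD(1)[OF v \<gamma>(1)] in auto)
qed

text \<open>At a minimum point of \<open>u\<close> over the network, zero is a slope to which the supersolution inequality
applies.\<close>

lemma discounted_lower_bound:
  assumes net: "network E" and u: "network_solution E H l u" and "l > 0"
    and C: "\<And>\<gamma> s. \<gamma> \<in> E \<Longrightarrow> s \<in> {0..1} \<Longrightarrow> H \<gamma> s 0 \<le> C"
    and y: "y \<in> net_support E"
  shows "- C \<le> l * u y"
proof -
  have "continuous_on (net_support E) u" using u by (simp add: network_solution_def)
  then obtain x where x: "x \<in> net_support E" "\<And>y. y \<in> net_support E \<Longrightarrow> u x \<le> u y"
    using continuous_attains_inf[OF compact_net_support[OF net]] y by blast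
  obtain \<gamma> \<sigma> where \<gamma>: "\<gamma> \<in> E" "0 < \<sigma>" "\<sigma> \<le> 1" "\<gamma> \<sigma> = x"
      and sc: "\<sigma> = 1 \<Longrightarrow> state_constraint l (H \<gamma>) (u \<circ> \<gamma>)"
    using arc_through_point[OF x(1), of "\<lambda>\<gamma>. state_constraint l (H \<gamma>) (u \<circ> \<gamma>)"] u
    unfolding network_solution_def by blast
  have "0 \<le> l * (u \<circ> \<gamma>) \<sigma> + H \<gamma> \<sigma> 0"
  proof (rule supersolution_touch[OF network_solutionD(3)[OF u \<gamma>(1)] \<gamma>(2,3) sc,
        where \<phi> = "\<lambda>_. 0" and D = "\<lambda>_. 0" and \<delta> = 1])
    show "(u \<circ> \<gamma>) \<sigma> - 0 \<le> (u \<circ> \<gamma>) t - 0" if "0 \<le> t" "t \<le> 1" for t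
      using x(2)[of "\<gamma> t"] \<gamma>(4) network_arcD(3)[OF net \<gamma>(1)] that by (simp add: image_subset_iff)
  qed auto
  then have "- C \<le> l * u x" using C[OF \<gamma>(1), of \<sigma>] \<gamma> by auto
  also have "\<dots> \<le> l * u y" using x(2)[OF y] \<open>l > 0\<close> by simp
  finally show ?thesis .
qed

section \<open>Uniform Lipschitz estimates and equicontinuity\<close>

text \<open>The Lipschitz condition refers to the parameters of the arcs. A Lipschitz condition for
the Euclidean distance does not follow in general: two arcs may leave a vertex tangentially.\<close>

definition arcwise_lipschitz ::
  "(real \<Rightarrow> 'a::euclidean_space) set \<Rightarrow> real \<Rightarrow> ('a \<Rightarrow> real) \<Rightarrow> bool" where
  "arcwise_lipschitz E R u \<longleftrightarrow>
     (\<forall>\<gamma>\<in>E. \<forall>s\<in>{0..1}. \<forall>t\<in>{0..1}. \<bar>u (\<gamma> s) - u (\<gamma> t)\<bar> \<le> R * \<bar>s - t\<bar>)"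

text \<open>The slope bound is one-sided; the opposite bound is the slope bound along the reversed arc.\<close>

lemma subsolution_arcwise_lipschitz:
  assumes net: "network E" and u: "network_solution E H l u"
    and C: "\<And>x. x \<in> net_support E \<Longrightarrow> - C \<le> l * u x"
    and R: "\<And>\<gamma> s p. \<gamma> \<in> E \<Longrightarrow> s \<in> {0..1} \<Longrightarrow> R \<le> p \<Longrightarrow> C < H \<gamma> s p"
  shows "arcwise_lipschitz E R u"
proof -
  have slope: "u (\<gamma> t) - u (\<gamma> s) \<le> R * (t - s)" if \<gamma>: "\<gamma> \<in> E" and st: "0 \<le> s" "s \<le> t" "t \<le> 1" for \<gamma> s t
  proof -
    have "(u \<circ> \<gamma>) t - (u \<circ> \<gamma>) s \<le> R * (t - s)"
    proof (rule subsolution_slope_bound[OF network_solutionD(2,1)[OF u \<gamma>] _ st])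
      show "0 < l * (u \<circ> \<gamma>) s' + H \<gamma> s' q" if "0 < s'" "s' < 1" "R \<le> q" for s' q
        using C[of "\<gamma> s'"] R[OF \<gamma>, of s' q] network_arcD(3)[OF net \<gamma>] that
        by (simp add: image_subset_iff)
    qed
    then show ?thesis by simp
  qed
  have "\<bar>u (\<gamma> s) - u (\<gamma> t)\<bar> \<le> R * \<bar>s - t\<bar>"
    if \<gamma>: "\<gamma> \<in> E" and st: "0 \<le> s" "s \<le> t" "t \<le> 1" for \<gamma> s t
    using slope[OF \<gamma> st] slope[OF network_arcD(2)[OF net \<gamma>], of "1 - t" "1 - s"] st
    by (auto simp: reversepath_def)
  then show ?thesis
    unfolding arcwise_lipschitz_def
    by (metis abs_minus_commute atLeastAtMost_iff linear)
qed

text \<open>Along a chain of arcs the increments add up. The finitely many pairs of vertices allow one bound \<open>K\<close>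
for all of them.\<close>

lemma arcwise_lipschitz_oscillation:
  fixes E :: "(real \<Rightarrow> 'a::euclidean_space) set"
  assumes net: "network E" and "0 \<le> R"
  shows "\<exists>K. \<forall>u. arcwise_lipschitz E R u \<longrightarrow>
    (\<forall>x\<in>net_support E. \<forall>y\<in>net_support E. \<bar>u x - u y\<bar> \<le> K)"
proof -
  let ?V = "net_vertices E"
  let ?link = "{(pathstart \<gamma>, pathfinish \<gamma>) | \<gamma>. \<gamma> \<in> E}"
  have arc: "\<bar>u (\<gamma> s) - u (\<gamma> t)\<bar> \<le> R"
    if "arcwise_lipschitz E R u" "\<gamma> \<in> E" "s \<in> {0..1}" "t \<in> {0..1}" for u \<gamma> s t
  proof -
    have "\<bar>u (\<gamma> s) - u (\<gamma> t)\<bar> \<le> R * \<bar>s - t\<bar>"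
      using that unfolding arcwise_lipschitz_def by blast
    also have "\<dots> \<le> R * 1" using that \<open>0 \<le> R\<close> by (intro mult_left_mono) auto
    finally show ?thesis by simp
  qed
  have chain: "\<exists>K. \<forall>u. arcwise_lipschitz E R u \<longrightarrow> \<bar>u x - u y\<bar> \<le> K" if "(x, y) \<in> ?link\<^sup>*" for x y
    using that
  proof (induction rule: rtrancl_induct)
    case base
    show ?case by (intro exI[of _ 0]) simp
  next
    case (step y z)
    then obtain K \<gamma> where K: "\<And>u. arcwise_lipschitz E R u \<Longrightarrow> \<bar>u x - u y\<bar> \<le> K"
      and \<gamma>: "\<gamma> \<in> E" "y = \<gamma> 0" "z = \<gamma> 1"
      by (auto simp: pathstart_def pathfinish_def)
    have "\<bar>u x - u z\<bar> \<le> K + R" if "arcwise_lipschitz E R u" for u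
      using K[OF that] arc[OF that \<gamma>(1), of 0 1] \<gamma> by auto
    then show ?case by blast
  qed
  have "\<exists>K. \<forall>p\<in>?V \<times> ?V. \<forall>u. arcwise_lipschitz E R u \<longrightarrow> \<bar>u (fst p) - u (snd p)\<bar> \<le> K"
  proof (rule finite_uniform_bound)
    show "finite (?V \<times> ?V)"
      using net by (simp add: network_def net_vertices_def)
    show "\<exists>K. \<forall>u. arcwise_lipschitz E R u \<longrightarrow> \<bar>u (fst p) - u (snd p)\<bar> \<le> K"
      if "p \<in> ?V \<times> ?V" for p
    proof (rule chain)
      have "fst p \<in> ?V" "snd p \<in> ?V" using that by (auto simp: mem_Times_iff)
      then show "(fst p, snd p) \<in> ?link\<^sup>*" using net unfolding network_def by blast
    qed
  qed (auto intro: order_trans)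
  then obtain K where K: "\<And>x y u. x \<in> ?V \<Longrightarrow> y \<in> ?V \<Longrightarrow> arcwise_lipschitz E R u \<Longrightarrow> \<bar>u x - u y\<bar> \<le> K"
    by force
  have "\<bar>u x - u y\<bar> \<le> K + 2 * R"
    if u: "arcwise_lipschitz E R u" and xy: "x \<in> net_support E" "y \<in> net_support E" for u x y
  proof -
    have "\<exists>v\<in>?V. \<bar>u x - u v\<bar> \<le> R" if x: "x \<in> net_support E" for x
    proof -
      obtain \<gamma> s where \<gamma>: "\<gamma> \<in> E" "s \<in> {0..1}" "x = \<gamma> s"
        using x by (auto simp: net_support_def path_image_def)
      then have "\<bar>u x - u (pathstart \<gamma>)\<bar> \<le> R"
        using arc[OF u \<gamma>(1,2), of 0] by (simp add: pathstart_def)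
      then show ?thesis using network_arcD(4)[OF net \<gamma>(1)] by blast
    qed
    then obtain v v' where "v \<in> ?V" "v' \<in> ?V" "\<bar>u x - u v\<bar> \<le> R" "\<bar>u y - u v'\<bar> \<le> R"
      using xy by meson
    then show ?thesis using K[OF _ _ u, of v v'] by fastforce
  qed
  then show ?thesis by blast
qed

text \<open>A point of the network close to \<open>x\<close> has, on any arc through it, a parameter close to some parameter at which the arc
passes through \<open>x\<close>: the other parameters of that arc form a compact set whose image misses \<open>x\<close>.\<close>

lemma arcwise_lipschitz_equicontinuous:
  fixes E :: "(real \<Rightarrow> 'a::euclidean_space) set"
  assumes net: "network E" and e: "0 < e" and R: "0 < R"
  shows "\<exists>d>0. \<forall>u y. arcwise_lipschitz E R u \<and> y \<in> net_support E \<and> norm (x - y) < d \<longrightarrow>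
    \<bar>u x - u y\<bar> < e"
proof -
  define far where "far \<gamma> = {0..1} - (\<Union>t\<in>{t\<in>{0..1}. \<gamma> t = x}. ball t (e / R))" for \<gamma> :: "real \<Rightarrow> 'a"
  have "compact (\<gamma> ` far \<gamma>)" if "\<gamma> \<in> E" for \<gamma>
  proof (rule compact_continuous_image)
    show "compact (far \<gamma>)" unfolding far_def by (intro compact_diff open_UN) auto
    show "continuous_on (far \<gamma>) \<gamma>"
      by (rule continuous_on_subset[OF network_arcD(1)[OF net that]]) (auto simp: far_def)
  qed
  then have "compact (\<Union>\<gamma>\<in>E. \<gamma> ` far \<gamma>)"
    using net by (intro compact_UN) (auto simp: network_def)
  moreover have "x \<notin> (\<Union>\<gamma>\<in>E. \<gamma> ` far \<gamma>)"
    using e R by (force simp: far_def)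
  ultimately obtain d where d: "d > 0" "\<And>y. y \<in> (\<Union>\<gamma>\<in>E. \<gamma> ` far \<gamma>) \<Longrightarrow> d \<le> dist x y"
    using separate_point_closed[OF compact_imp_closed] by metis
  have "\<bar>u x - u y\<bar> < e"
    if u: "arcwise_lipschitz E R u" and y: "y \<in> net_support E" and "norm (x - y) < d" for u y
  proof -
    obtain \<gamma> s where \<gamma>: "\<gamma> \<in> E" "s \<in> {0..1}" "y = \<gamma> s"
      using y by (auto simp: net_support_def path_image_def)
    have "s \<notin> far \<gamma>" using d(2)[of y] \<gamma> \<open>norm (x - y) < d\<close> by (force simp: dist_norm)
    then obtain t where t: "t \<in> {0..1}" "\<gamma> t = x" "\<bar>t - s\<bar> < e / R"
      using \<gamma>(2) by (auto simp: far_def dist_real_def)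
    have "\<bar>u x - u y\<bar> \<le> R * \<bar>t - s\<bar>"
      using u \<gamma> t unfolding arcwise_lipschitz_def by blast
    also have "\<dots> < e" using t(3) R by (simp add: pos_less_divide_eq mult.commute)
    finally show ?thesis .
  qed
  with d(1) show ?thesis by blast
qed

section \<open>Bounds uniform in the discount factor, and the limit\<close>

text \<open>The arc carrying the state constraint at a vertex may change with \<open>n\<close>; finitely many arcs are
available, so it is the same along a subsequence, and stability is applied to that subsequence.\<close>

lemma network_solution_limit:
  fixes E :: "(real \<Rightarrow> 'a::euclidean_space) set"
  assumes net: "network E" and ham: "network_hamiltonian E H"
    and sol: "\<And>n. network_solution E H (\<mu> n) (f n)"
    and \<mu>: "\<mu> \<longlonglongrightarrow> l" and lim: "uniform_limit (net_support E) f v sequentially"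
  shows "network_solution E H l v"
proof -
  have lim_arc: "uniform_limit {0..1} (\<lambda>n. f n \<circ> \<gamma>) (v \<circ> \<gamma>) sequentially" if "\<gamma> \<in> E" for \<gamma>
    using uniform_limit_compose'[OF lim, of \<gamma> "{0..1}"] network_arcD(3)[OF net that]
    by (auto simp: o_def)
  have v: "continuous_on (net_support E) v"
    by (rule uniform_limit_theorem[OF always_eventually lim])
      (use sol in \<open>auto simp: network_solution_def\<close>)
  have "viscosity_solution l (H \<gamma>) (v \<circ> \<gamma>)" if \<gamma>: "\<gamma> \<in> E" for \<gamma>
    unfolding viscosity_solution_def
  proof (intro conjI)
    show "continuous_on {0..1} (v \<circ> \<gamma>)"
      using network_arcD(1,3)[OF net \<gamma>] continuous_on_subset[OF v] by (intro continuous_on_compose) auto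
    show "viscosity_subsolution l (H \<gamma>) (v \<circ> \<gamma>)"
      by (rule subsolution_limit[OF network_hamiltonianD(1)[OF ham \<gamma>] network_solutionD(1)[OF sol \<gamma>]
            lim_arc[OF \<gamma>] \<mu> network_solutionD(2)[OF sol \<gamma>]])
    show "viscosity_supersolution l (H \<gamma>) (v \<circ> \<gamma>)"
      by (rule supersolution_limit[OF network_hamiltonianD(1)[OF ham \<gamma>] network_solutionD(1)[OF sol \<gamma>]
            lim_arc[OF \<gamma>] \<mu> network_solutionD(3)[OF sol \<gamma>]])
  qed
  moreover have "\<exists>\<gamma>\<in>E. pathfinish \<gamma> = x \<and> state_constraint l (H \<gamma>) (v \<circ> \<gamma>)"
    if x: "x \<in> net_vertices E" for x
  proof -
    have "\<exists>\<gamma>\<in>E. pathfinish \<gamma> = x \<and> state_constraint (\<mu> n) (H \<gamma>) (f n \<circ> \<gamma>)" for n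
      using sol x unfolding network_solution_def by blast
    then obtain G where G: "\<And>n. G n \<in> E" "\<And>n. pathfinish (G n) = x"
        "\<And>n. state_constraint (\<mu> n) (H (G n)) (f n \<circ> G n)"
      by metis
    have "finite (range G)"
      using net G(1) by (intro finite_subset[of "range G" E]) (auto simp: network_def)
    then obtain n0 where "infinite {n. G n = G n0}"
      using pigeonhole_infinite[of "UNIV :: nat set" G] by auto
    from infinite_enumerate[OF this] obtain r :: "nat \<Rightarrow> nat" where r: "strict_mono r" "\<And>n. G (r n) = G n0"
      by auto
    have "state_constraint l (H (G n0)) (v \<circ> G n0)"
    proof (rule state_constraint_limit[where f = "\<lambda>n. f (r n) \<circ> G n0" and \<mu> = "\<lambda>n. \<mu> (r n)"])
      show "uniform_limit {0..1} (\<lambda>n. f (r n) \<circ> G n0) (v \<circ> G n0) sequentially"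
        using filterlim_compose[OF lim_arc[OF G(1)] filterlim_subseq[OF r(1)]] by simp
      show "(\<lambda>n. \<mu> (r n)) \<longlonglongrightarrow> l"
        using LIMSEQ_subseq_LIMSEQ[OF \<mu> r(1)] by (simp add: o_def)
      show "state_constraint (\<mu> (r n)) (H (G n0)) (f (r n) \<circ> G n0)" for n
        using G(3)[of "r n"] r(2)[of n] by simp
    qed (rule network_hamiltonianD(1)[OF ham G(1)] network_solutionD(1,3)[OF sol G(1)])+
    then show ?thesis using G(1,2) by blast
  qed
  ultimately show ?thesis using v by (simp add: network_solution_def)
qed

text \<open>The constants depend on the Hamiltonians only, not on the discount factor: the lower bound of
\<open>l * u\<close> is \<open>- C\<close> for every \<open>l\<close>. A point where \<open>u\<close> is nonpositive and one where
it is nonnegative turn the oscillation bound into a bound of \<open>u\<close>.\<close>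

lemma discounted_solutions_bounded:
  fixes E :: "(real \<Rightarrow> 'a::euclidean_space) set"
  assumes net: "network E" and ham: "network_hamiltonian E H" and crit: "is_critical_value E H 0"
  obtains R K where "0 < R"
    "\<And>l u. l > 0 \<Longrightarrow> network_solution E H l u \<Longrightarrow> arcwise_lipschitz E R u"
    "\<And>l u x. l > 0 \<Longrightarrow> network_solution E H l u \<Longrightarrow> x \<in> net_support E \<Longrightarrow> \<bar>u x\<bar> \<le> K"
proof -
  have "finite E" using net by (simp add: network_def)
  have "\<exists>C. \<forall>s\<in>{0..1}. H \<gamma> s 0 \<le> C" if "\<gamma> \<in> E" for \<gamma>
  proof -
    have "continuous_on {0..1} (\<lambda>s. (\<lambda>(s, p). H \<gamma> s p) (s, 0))"
      by (rule continuous_on_compose2[OF network_hamiltonianD(1)[OF ham that]])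
        (auto intro!: continuous_intros)
    then have "\<exists>x\<in>{0..1}. \<forall>s\<in>{0..1}. H \<gamma> s 0 \<le> H \<gamma> x 0"
      by (intro continuous_attains_sup) auto
    then show ?thesis by blast
  qed
  then have "\<exists>C. \<forall>\<gamma>\<in>E. \<forall>s\<in>{0..1}. H \<gamma> s 0 \<le> C"
    by (rule finite_uniform_bound[OF \<open>finite E\<close>]) (blast intro: order_trans)+
  then obtain C where C: "\<And>\<gamma> s. \<gamma> \<in> E \<Longrightarrow> s \<in> {0..1} \<Longrightarrow> H \<gamma> s 0 \<le> C" by blast
  have "\<exists>R. \<forall>\<gamma>\<in>E. \<forall>s\<in>{0..1}. \<forall>p. \<bar>p\<bar> \<ge> R \<longrightarrow> H \<gamma> s p \<ge> C + 1"
    by (rule finite_uniform_bound[OF \<open>finite E\<close> network_hamiltonianD(2)[OF ham]]) auto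
  then obtain R0 where R0: "\<And>\<gamma> s p. \<gamma> \<in> E \<Longrightarrow> s \<in> {0..1} \<Longrightarrow> \<bar>p\<bar> \<ge> R0 \<Longrightarrow> H \<gamma> s p \<ge> C + 1"
    by blast
  define R where "R = max R0 1"
  have "R > 0" by (simp add: R_def)
  have lip: "arcwise_lipschitz E R u" if "l > 0" "network_solution E H l u" for l u
  proof (rule subsolution_arcwise_lipschitz[OF net that(2)])
    show "- C \<le> l * u x" if "x \<in> net_support E" for x
      using discounted_lower_bound[OF net \<open>network_solution E H l u\<close> \<open>l > 0\<close>] C that by blast
    show "C < H \<gamma> s p" if "\<gamma> \<in> E" "s \<in> {0..1}" "R \<le> p" for \<gamma> s p
      using R0[OF that(1,2), of p] that(3) by (auto simp: R_def)
  qed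
  obtain K where K: "\<And>u x y. arcwise_lipschitz E R u \<Longrightarrow> x \<in> net_support E \<Longrightarrow> y \<in> net_support E \<Longrightarrow>
      \<bar>u x - u y\<bar> \<le> K"
    using arcwise_lipschitz_oscillation[OF net, of R] \<open>R > 0\<close> by auto
  obtain v where v: "eikonal_solution E H v" using crit by (auto simp: is_critical_value_def)
  have "\<bar>u x\<bar> \<le> K" if l: "l > 0" and u: "network_solution E H l u" and x: "x \<in> net_support E" for l u x
  proof -
    have "E \<noteq> {}" using x by (auto simp: net_support_def)
    note comparison = network_level_comparison[OF net ham this]
    have cont: "continuous_on (net_support E) u" using u by (simp add: network_solution_def)
    obtain y where y: "y \<in> net_support E" "\<And>x. x \<in> net_support E \<Longrightarrow> u y \<le> u x"
      using continuous_attains_inf[OF compact_net_support[OF net] _ cont] x by blast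
    obtain z where z: "z \<in> net_support E" "\<And>x. x \<in> net_support E \<Longrightarrow> u x \<le> u z"
      using continuous_attains_sup[OF compact_net_support[OF net] _ cont] x by blast
    \<comment> \<open>The subsolution \<open>u\<close> has level \<open>- l * min u\<close>, the supersolution \<open>v\<close> level 0; below, the roles
      are exchanged.\<close>
    have "0 \<le> - (l * u y)"
      by (rule comparison[OF u v]) (use y l in auto)
    then have "u y \<le> 0" using l by (simp add: mult_le_0_iff)
    moreover have "- (l * u z) \<le> 0"
      by (rule comparison[OF v u]) (use z l in auto)
    then have "0 \<le> u z" using l by (simp add: zero_le_mult_iff)
    ultimately show ?thesis
      using K[OF lip[OF l u] x y(1)] K[OF lip[OF l u] x z(1)] by linarith
  qed
  with that \<open>R > 0\<close> lip show ?thesis by blast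
qed

theorem proposition8p6:
  fixes E :: "(real \<Rightarrow> 'a::euclidean_space) set"
    and H :: "(real \<Rightarrow> 'a) \<Rightarrow> real \<Rightarrow> real \<Rightarrow> real"
    and u :: "real \<Rightarrow> 'a \<Rightarrow> real"
    and lam :: "nat \<Rightarrow> real"
  assumes "network E"
    and "network_hamiltonian E H"
    and "is_critical_value E H 0"
    and "\<And>l. l > 0 \<Longrightarrow> network_solution E H l (u l)"
    and "\<And>n. lam n > 0"
    and "lam \<longlonglongrightarrow> 0"
  shows "\<exists>r v. strict_mono (r :: nat \<Rightarrow> nat) \<and>
           uniform_limit (net_support E) (\<lambda>n. u (lam (r n))) v sequentially \<and>
           eikonal_solution E H v"
proof -
  have sol: "network_solution E H (lam n) (u (lam n))" for n
    using assms(4,5) by blast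
  obtain R K where R: "0 < R" and lip: "\<And>n. arcwise_lipschitz E R (u (lam n))"
    and K: "\<And>n x. x \<in> net_support E \<Longrightarrow> \<bar>u (lam n) x\<bar> \<le> K"
    using discounted_solutions_bounded[OF assms(1-3)] assms(5) sol by metis
  obtain v r where r: "strict_mono (r :: nat \<Rightarrow> nat)"
    and v: "\<And>e. 0 < e \<Longrightarrow> \<exists>N. \<forall>n x. n \<ge> N \<and> x \<in> net_support E \<longrightarrow> norm (u (lam (r n)) x - v x) < e"
  proof (rule Arzela_Ascoli[of "net_support E" "\<lambda>n. u (lam n)" K])
    show "\<exists>d>0. \<forall>n y. y \<in> net_support E \<and> norm (x - y) < d \<longrightarrow> norm (u (lam n) x - u (lam n) y) < e"
      if "0 < e" for x e
      using arcwise_lipschitz_equicontinuous[OF assms(1) that R, of x] lip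
      unfolding real_norm_def by meson
  qed (use K compact_net_support[OF assms(1)] in auto)
  have lim: "uniform_limit (net_support E) (\<lambda>n. u (lam (r n))) v sequentially"
    unfolding uniform_limit_iff eventually_sequentially dist_norm using v by blast
  moreover have "(\<lambda>n. lam (r n)) \<longlonglongrightarrow> 0"
    using LIMSEQ_subseq_LIMSEQ[OF assms(6) r] by (simp add: o_def)
  then have "eikonal_solution E H v"
    by (rule network_solution_limit[OF assms(1,2) sol _ lim])
  ultimately show ?thesis using r by blast
qed

end
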